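(* Let $\tilde M=\mathbb R\times M$ and let $L(\tau,v)=-\Lambda\tau^2+2B(v)\tau+F^2(v)$, with $\Lambda,B,F$ as in the context. (i) Assume that $(\partial^2_{yy}B)_v$ is positive semi-definite for all $v\in TM\setminus0$ and that for each $x\in M$ either $B(x,v)\ge0$ for all $v\in T_xM$ or $B(x,\cdot)$ is linear on $T_xM$. Then a vector $(\tau,v)\in T\tilde M$ with $\tau>0$ is a causal vector of $(\tilde M,L)$ if and only if it is a causal, future-pointing vector of $(\tilde M,L_B)$. (ii) Assume that $(\partial^2_{yy}B)_v$ is negative semi-definite for all $v\in TM\setminus0$ and that for each $x\in M$ either $B(x,v)\le0$ for all $v\in T_xM$ or $B(x,\cdot)$ is linear on $T_xM$. Then a vector $(\tau,v)\in T\tilde M$ with $\tau<0$ is a causal vector of $(\tilde M,L)$ if and only if it is a causal, past-pointing vector of $(\tilde M,L_{B^-})$.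
   Context: $M$ is a smooth manifold; $\Lambda$ is a positive (smooth) function on $M$; $B:TM\to\mathbb R$ is fiberwise positively homogeneous of degree 1 and at least $C^3$ on $TM\setminus0$; $F:TM\to[0,+\infty)$ is a Finsler metric, i.e. $F\in C^0(TM)\cap C^3(TM\setminus 0)$, fiberwise positively homogeneous of degree 1, with the fiberwise Hessian of $\frac12F^2$ positive definite at every $v\in TM\setminus0$. $(\partial^2_{yy}B)_v$ denotes the fiberwise Hessian of $B$ at $v$. Tangent vectors of $\tilde M=\mathbb R\times M$ are written $(\tau,v)$, $\tau\in\mathbb R$, $v\in TM$. Under (i) or (ii) $(\tilde M,L)$ is called a stationary splitting Finsler spacetime. Set $F_B=\frac B\Lambda+\sqrt{\frac{B^2}{\Lambda^2}+\frac{F^2}{\Lambda}}$ and $F_B^-=-\frac B\Lambda+\sqrt{\frac{B^2}{\Lambda^2}+\frac{F^2}{\Lambda}}$, and $L_B(\tau,v)=-\tau^2+F_B^2(v)$, $L_{B^-}(\tau,v)=-\tau^2+(F_B^-)^2(v)$. A non-zero vector $w$ is causal for a Lorentz–Finsler function $L$ if $L(w)\le0$. For $L_1(\tau,v)=-\tau^2+F_1^2(v)$ with $F_1$ a Finsler metric on $M$ and time orientation given by $\partial_t$, a causal vector $(\tau,v)$ is future-pointing if $\tau\ge F_1(v)$ and past-pointing if $\tau\le-F_1(v)$. *)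

theory Defs
  imports "HOL-Analysis.Analysis"
begin

section \<open>Differentiability classes on open sets of a Euclidean space\<close>

(* Meant for open S: the derivatives are full derivatives at the points of S. *)
primrec Ck_on :: "nat \<Rightarrow> ('a::euclidean_space \<Rightarrow> 'b::real_normed_vector) \<Rightarrow> 'a set \<Rightarrow> bool" where
  "Ck_on 0 f S \<longleftrightarrow> continuous_on S f"
| "Ck_on (Suc k) f S \<longleftrightarrow> (\<forall>x\<in>S. f differentiable (at x)) \<and>
     (\<forall>u. Ck_on k (\<lambda>x. frechet_derivative f (at x) u) S)"

definition smooth_on :: "('a::euclidean_space \<Rightarrow> 'b::real_normed_vector) \<Rightarrow> 'a set \<Rightarrow> bool" where
  "smooth_on f S \<longleftrightarrow> (\<forall>k. Ck_on k f S)"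

section \<open>Smooth manifolds and their tangent bundles\<close>

(* A chart is a pair (U, \<phi>); the values of \<phi> outside U are irrelevant. *)
type_synonym ('m, 'e) chart = "'m set \<times> ('m \<Rightarrow> 'e)"

definition transition :: "('m, 'e) chart \<Rightarrow> ('m, 'e) chart \<Rightarrow> 'e \<Rightarrow> 'e" where
  "transition c d = snd d \<circ> inv_into (fst c) (snd c)"

definition is_chart :: "'m topology \<Rightarrow> ('m, 'e::euclidean_space) chart \<Rightarrow> bool" where
  "is_chart X c \<longleftrightarrow> openin X (fst c) \<and> open (snd c ` fst c) \<and>
     homeomorphic_map (subtopology X (fst c)) (top_of_set (snd c ` fst c)) (snd c)"

definition smooth_manifold :: "'m topology \<Rightarrow> ('m, 'e::euclidean_space) chart set \<Rightarrow> bool" where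
  "smooth_manifold M A \<longleftrightarrow> Hausdorff_space M \<and> second_countable M \<and>
     (\<forall>c\<in>A. is_chart M c) \<and> \<Union> (fst ` A) = topspace M \<and>
     (\<forall>c\<in>A. \<forall>d\<in>A. smooth_on (transition c d) (snd c ` (fst c \<inter> fst d)))"

definition smooth_function :: "('m, 'e::euclidean_space) chart set \<Rightarrow> ('m \<Rightarrow> real) \<Rightarrow> bool" where
  "smooth_function A f \<longleftrightarrow>
     (\<forall>c\<in>A. smooth_on (f \<circ> inv_into (fst c) (snd c)) (snd c ` fst c))"

(* A tangent vector at p is the family of its coordinate representations in the charts around p,
   which transform by the differentials of the coordinate changes; the value on any other
   argument is set to 0, so that equal vectors are equal functions. *)
type_synonym ('m, 'e) tvec = "('m, 'e) chart \<Rightarrow> 'e"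

definition tangent_space :: "('m, 'e::euclidean_space) chart set \<Rightarrow> 'm \<Rightarrow> ('m, 'e) tvec set" where
  "tangent_space A p = {v.
     (\<forall>c. \<not> (c \<in> A \<and> p \<in> fst c) \<longrightarrow> v c = 0) \<and>
     (\<forall>c\<in>A. \<forall>d\<in>A. p \<in> fst c \<and> p \<in> fst d \<longrightarrow>
        v d = frechet_derivative (transition c d) (at (snd c p)) (v c))}"

definition tzero :: "('m, 'e::euclidean_space) tvec" where
  "tzero = (\<lambda>c. 0)"

definition tadd :: "('m, 'e::euclidean_space) tvec \<Rightarrow> ('m, 'e) tvec \<Rightarrow> ('m, 'e) tvec" where
  "tadd v w = (\<lambda>c. v c + w c)"

definition tscale :: "real \<Rightarrow> ('m, 'e::euclidean_space) tvec \<Rightarrow> ('m, 'e) tvec" where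
  "tscale r v = (\<lambda>c. r *\<^sub>R v c)"

(* The tangent vector at p whose coordinates in the chart c are y. *)
definition tvec_of :: "('m, 'e::euclidean_space) chart set \<Rightarrow> ('m, 'e) chart \<Rightarrow> 'm \<Rightarrow> 'e \<Rightarrow> ('m, 'e) tvec" where
  "tvec_of A c p y = (\<lambda>d. if d \<in> A \<and> p \<in> fst d
     then frechet_derivative (transition c d) (at (snd c p)) y else 0)"

text \<open>A function on \<open>TM\<close> is curried, \<open>f x v\<close> with \<open>v\<close> a tangent vector at \<open>x\<close>.\<close>

definition coord_expr :: "('m, 'e::euclidean_space) chart set \<Rightarrow> ('m, 'e) chart \<Rightarrow>
    ('m \<Rightarrow> ('m, 'e) tvec \<Rightarrow> real) \<Rightarrow> 'e \<times> 'e \<Rightarrow> real" where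
  "coord_expr A c f = (\<lambda>(x, y). let p = inv_into (fst c) (snd c) x in f p (tvec_of A c p y))"

definition Ck_TM :: "nat \<Rightarrow> ('m, 'e::euclidean_space) chart set \<Rightarrow>
    ('m \<Rightarrow> ('m, 'e) tvec \<Rightarrow> real) \<Rightarrow> bool" where
  "Ck_TM k A f \<longleftrightarrow> (\<forall>c\<in>A. Ck_on k (coord_expr A c f) ((snd c ` fst c) \<times> UNIV))"

definition Ck_TM_minus_zero :: "nat \<Rightarrow> ('m, 'e::euclidean_space) chart set \<Rightarrow>
    ('m \<Rightarrow> ('m, 'e) tvec \<Rightarrow> real) \<Rightarrow> bool" where
  "Ck_TM_minus_zero k A f \<longleftrightarrow>
     (\<forall>c\<in>A. Ck_on k (coord_expr A c f) ((snd c ` fst c) \<times> (UNIV - {0})))"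

section \<open>Fiberwise notions and Finsler metrics\<close>

definition pos_homogeneous1 :: "'m topology \<Rightarrow> ('m, 'e::euclidean_space) chart set \<Rightarrow>
    ('m \<Rightarrow> ('m, 'e) tvec \<Rightarrow> real) \<Rightarrow> bool" where
  "pos_homogeneous1 M A f \<longleftrightarrow>
     (\<forall>x\<in>topspace M. \<forall>v\<in>tangent_space A x. \<forall>r>0. f x (tscale r v) = r * f x v)"

definition fiber_linear :: "('m, 'e::euclidean_space) chart set \<Rightarrow>
    ('m \<Rightarrow> ('m, 'e) tvec \<Rightarrow> real) \<Rightarrow> 'm \<Rightarrow> bool" where
  "fiber_linear A f x \<longleftrightarrow>
     (\<forall>v\<in>tangent_space A x. \<forall>w\<in>tangent_space A x. f x (tadd v w) = f x v + f x w) \<and>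
     (\<forall>v\<in>tangent_space A x. \<forall>r. f x (tscale r v) = r * f x v)"

(* The second derivative of f x at v, restricted to the vector space of tangent vectors at x,
   as a bilinear form in the directions u and w. *)
definition fiber_hessian :: "('m \<Rightarrow> ('m, 'e::euclidean_space) tvec \<Rightarrow> real) \<Rightarrow>
    'm \<Rightarrow> ('m, 'e) tvec \<Rightarrow> ('m, 'e) tvec \<Rightarrow> ('m, 'e) tvec \<Rightarrow> real" where
  "fiber_hessian f x v u w =
     deriv (\<lambda>s. deriv (\<lambda>r. f x (tadd v (tadd (tscale s u) (tscale r w)))) 0) 0"

definition fiber_hessian_pos_def :: "'m topology \<Rightarrow> ('m, 'e::euclidean_space) chart set \<Rightarrow>
    ('m \<Rightarrow> ('m, 'e) tvec \<Rightarrow> real) \<Rightarrow> bool" where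
  "fiber_hessian_pos_def M A f \<longleftrightarrow>
     (\<forall>x\<in>topspace M. \<forall>v\<in>tangent_space A x - {tzero}. \<forall>u\<in>tangent_space A x - {tzero}.
        fiber_hessian f x v u u > 0)"

definition fiber_hessian_pos_semidef :: "'m topology \<Rightarrow> ('m, 'e::euclidean_space) chart set \<Rightarrow>
    ('m \<Rightarrow> ('m, 'e) tvec \<Rightarrow> real) \<Rightarrow> bool" where
  "fiber_hessian_pos_semidef M A f \<longleftrightarrow>
     (\<forall>x\<in>topspace M. \<forall>v\<in>tangent_space A x - {tzero}. \<forall>u\<in>tangent_space A x.
        fiber_hessian f x v u u \<ge> 0)"

definition fiber_hessian_neg_semidef :: "'m topology \<Rightarrow> ('m, 'e::euclidean_space) chart set \<Rightarrow>
    ('m \<Rightarrow> ('m, 'e) tvec \<Rightarrow> real) \<Rightarrow> bool" where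
  "fiber_hessian_neg_semidef M A f \<longleftrightarrow>
     (\<forall>x\<in>topspace M. \<forall>v\<in>tangent_space A x - {tzero}. \<forall>u\<in>tangent_space A x.
        fiber_hessian f x v u u \<le> 0)"

definition finsler_metric :: "'m topology \<Rightarrow> ('m, 'e::euclidean_space) chart set \<Rightarrow>
    ('m \<Rightarrow> ('m, 'e) tvec \<Rightarrow> real) \<Rightarrow> bool" where
  "finsler_metric M A F \<longleftrightarrow>
     (\<forall>x\<in>topspace M. \<forall>v\<in>tangent_space A x. F x v \<ge> 0) \<and>
     Ck_TM 0 A F \<and> Ck_TM_minus_zero 3 A F \<and> pos_homogeneous1 M A F \<and>
     fiber_hessian_pos_def M A (\<lambda>x v. (F x v)\<^sup>2 / 2)"

section \<open>Lorentz-Finsler functions on the product of the line with \<open>M\<close>\<close>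

(* ((t, x), (\<tau>, v)) is the tangent vector (\<tau>, v) at the point (t, x) of the product, where
   the tangent space at (t, x) is identified with the product of the line and the one at x. *)
type_synonym ('m, 'e) split_vec = "(real \<times> 'm) \<times> (real \<times> ('m, 'e) tvec)"

definition split_TM :: "'m topology \<Rightarrow> ('m, 'e::euclidean_space) chart set \<Rightarrow> ('m, 'e) split_vec set" where
  "split_TM M A = {((t, x), (\<tau>, v)) | t x \<tau> v. x \<in> topspace M \<and> v \<in> tangent_space A x}"

fun split_L :: "('m \<Rightarrow> real) \<Rightarrow> ('m \<Rightarrow> ('m, 'e) tvec \<Rightarrow> real) \<Rightarrow> ('m \<Rightarrow> ('m, 'e) tvec \<Rightarrow> real) \<Rightarrow>
    ('m, 'e) split_vec \<Rightarrow> real" where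
  "split_L \<Lambda> B F ((t, x), (\<tau>, v)) = - \<Lambda> x * \<tau>\<^sup>2 + 2 * B x v * \<tau> + (F x v)\<^sup>2"

fun static_L :: "('m \<Rightarrow> ('m, 'e) tvec \<Rightarrow> real) \<Rightarrow> ('m, 'e) split_vec \<Rightarrow> real" where
  "static_L F\<^sub>1 ((t, x), (\<tau>, v)) = - \<tau>\<^sup>2 + (F\<^sub>1 x v)\<^sup>2"

definition F_B :: "('m \<Rightarrow> real) \<Rightarrow> ('m \<Rightarrow> ('m, 'e) tvec \<Rightarrow> real) \<Rightarrow> ('m \<Rightarrow> ('m, 'e) tvec \<Rightarrow> real) \<Rightarrow>
    'm \<Rightarrow> ('m, 'e) tvec \<Rightarrow> real" where
  "F_B \<Lambda> B F x v = B x v / \<Lambda> x + sqrt ((B x v)\<^sup>2 / (\<Lambda> x)\<^sup>2 + (F x v)\<^sup>2 / \<Lambda> x)"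

definition F_B_minus :: "('m \<Rightarrow> real) \<Rightarrow> ('m \<Rightarrow> ('m, 'e) tvec \<Rightarrow> real) \<Rightarrow> ('m \<Rightarrow> ('m, 'e) tvec \<Rightarrow> real) \<Rightarrow>
    'm \<Rightarrow> ('m, 'e) tvec \<Rightarrow> real" where
  "F_B_minus \<Lambda> B F x v = - B x v / \<Lambda> x + sqrt ((B x v)\<^sup>2 / (\<Lambda> x)\<^sup>2 + (F x v)\<^sup>2 / \<Lambda> x)"

definition causal :: "'m topology \<Rightarrow> ('m, 'e::euclidean_space) chart set \<Rightarrow>
    (('m, 'e) split_vec \<Rightarrow> real) \<Rightarrow> ('m, 'e) split_vec \<Rightarrow> bool" where
  "causal M A L w \<longleftrightarrow> w \<in> split_TM M A \<and> snd w \<noteq> (0, tzero) \<and> L w \<le> 0"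

(* Time orientation of static_L F1 given by the coordinate field of the line; to be applied to
   causal vectors of static_L F1. *)
fun future_pointing :: "('m \<Rightarrow> ('m, 'e) tvec \<Rightarrow> real) \<Rightarrow> ('m, 'e) split_vec \<Rightarrow> bool" where
  "future_pointing F\<^sub>1 ((t, x), (\<tau>, v)) \<longleftrightarrow> \<tau> \<ge> F\<^sub>1 x v"

fun past_pointing :: "('m \<Rightarrow> ('m, 'e) tvec \<Rightarrow> real) \<Rightarrow> ('m, 'e) split_vec \<Rightarrow> bool" where
  "past_pointing F\<^sub>1 ((t, x), (\<tau>, v)) \<longleftrightarrow> \<tau> \<le> - F\<^sub>1 x v"

end

theory Submission
  imports Defs
begin

text \<open>
  Fix a tangent vector \<open>v\<close> at \<open>x\<close>. As a function of \<open>\<tau>\<close>, \<open>L\<close> is a quadratic polynomial with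
  leading coefficient \<open>- \<Lambda> x < 0\<close> and with discriminant \<open>4 (B\<^sup>2 + \<Lambda> F\<^sup>2) \<ge> 0\<close>, and its roots are
  \<open>F\<^sub>B\<close> and \<open>- F\<^sub>B\<^sup>-\<close> (lemma \<open>split_L_factorization\<close>). The product \<open>- F\<^sup>2 / \<Lambda>\<close> of the roots is
  nonpositive, so that the roots lie on the two sides of \<open>0\<close> (lemmas \<open>F_B_nonneg\<close> and
  \<open>F_B_minus_nonneg\<close>). Hence for \<open>\<tau> > 0\<close> the factor
  \<open>\<tau> + F\<^sub>B\<^sup>-\<close> is positive, and \<open>L \<le> 0\<close> means \<open>\<tau> \<ge> F\<^sub>B\<close>. As \<open>F\<^sub>B \<ge> 0\<close>, that inequality already
  implies \<open>\<tau>\<^sup>2 \<ge> F\<^sub>B\<^sup>2\<close>, so it says exactly that the vector is causal and future-pointing for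
  \<open>L\<^sub>B\<close>.

  Replacing \<open>(\<tau>, B)\<close> by \<open>(- \<tau>, - B)\<close> leaves \<open>L\<close> unchanged (lemma \<open>split_L_reflection\<close>), and
  replacing \<open>B\<close> by \<open>- B\<close> exchanges \<open>F\<^sub>B\<close> with \<open>F\<^sub>B\<^sup>-\<close> (lemma \<open>F_B_minus_eq_F_B_uminus\<close>); thus for
  \<open>\<tau> < 0\<close> the same argument, applied to \<open>- \<tau>\<close> and \<open>- B\<close>, turns \<open>L \<le> 0\<close> into \<open>- \<tau> \<ge> F\<^sub>B\<^sup>-\<close>, which
  says that the vector is causal and past-pointing.
\<close>

lemma F_B_nonneg:
  assumes "\<Lambda> x > 0"
  shows "F_B \<Lambda> B F x v \<ge> 0"
proof -
  have "\<bar>B x v / \<Lambda> x\<bar> \<le> sqrt ((B x v)\<^sup>2 / (\<Lambda> x)\<^sup>2 + (F x v)\<^sup>2 / \<Lambda> x)"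
    using assms by (intro real_le_rsqrt) (simp add: power_divide)
  then show ?thesis
    unfolding F_B_def by linarith
qed

lemma F_B_minus_eq_F_B_uminus: "F_B_minus \<Lambda> B F = F_B \<Lambda> (\<lambda>x v. - B x v) F"
  by (intro ext) (simp add: F_B_def F_B_minus_def)

lemma F_B_minus_nonneg:
  assumes "\<Lambda> x > 0"
  shows "F_B_minus \<Lambda> B F x v \<ge> 0"
  using assms by (simp add: F_B_minus_eq_F_B_uminus F_B_nonneg)

lemma split_L_factorization:
  assumes "\<Lambda> x > 0"
  shows "split_L \<Lambda> B F ((t, x), (\<tau>, v)) =
    - \<Lambda> x * ((\<tau> - F_B \<Lambda> B F x v) * (\<tau> + F_B_minus \<Lambda> B F x v))"
proof -
  define r where "r = sqrt ((B x v)\<^sup>2 / (\<Lambda> x)\<^sup>2 + (F x v)\<^sup>2 / \<Lambda> x)"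
  have r2: "r\<^sup>2 = (B x v)\<^sup>2 / (\<Lambda> x)\<^sup>2 + (F x v)\<^sup>2 / \<Lambda> x"
    unfolding r_def using assms by simp
  have "(\<tau> - F_B \<Lambda> B F x v) * (\<tau> + F_B_minus \<Lambda> B F x v) = (\<tau> - B x v / \<Lambda> x)\<^sup>2 - r\<^sup>2"
    unfolding F_B_def F_B_minus_def r_def[symmetric]
    by (simp add: power2_eq_square algebra_simps add_divide_distrib)
  also have "\<dots> = \<tau>\<^sup>2 - 2 * B x v * \<tau> / \<Lambda> x - (F x v)\<^sup>2 / \<Lambda> x"
    unfolding r2 by (simp add: power2_diff power_divide)
  finally have product: "(\<tau> - F_B \<Lambda> B F x v) * (\<tau> + F_B_minus \<Lambda> B F x v) =
    \<tau>\<^sup>2 - 2 * B x v * \<tau> / \<Lambda> x - (F x v)\<^sup>2 / \<Lambda> x" .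
  show ?thesis
    unfolding product split_L.simps using assms by (simp add: field_simps)
qed

lemma split_L_nonpos_iff_F_B_le:
  assumes "\<Lambda> x > 0" and "\<tau> > 0"
  shows "split_L \<Lambda> B F ((t, x), (\<tau>, v)) \<le> 0 \<longleftrightarrow> F_B \<Lambda> B F x v \<le> \<tau>"
proof -
  have "\<tau> + F_B_minus \<Lambda> B F x v > 0"
    using F_B_minus_nonneg[of \<Lambda> x B F v] assms by linarith
  then show ?thesis
    using assms(1) unfolding split_L_factorization[where \<Lambda> = \<Lambda> and x = x, OF assms(1)]
    by (simp add: zero_le_mult_iff)
qed

lemma split_L_reflection:
  "split_L \<Lambda> B F ((t, x), (\<tau>, v)) = split_L \<Lambda> (\<lambda>x v. - B x v) F ((t, x), (- \<tau>, v))"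
  by simp

lemma static_L_nonpos_if_le_abs:
  assumes "0 \<le> F\<^sub>1 x v" and "F\<^sub>1 x v \<le> \<bar>\<tau>\<bar>"
  shows "static_L F\<^sub>1 ((t, x), (\<tau>, v)) \<le> 0"
  using power_mono[OF assms(2,1), of 2] by simp

lemma causal_split_L_iff_future_pointing:
  assumes "\<Lambda> x > 0" and "\<tau> > 0"
  shows "causal M A (split_L \<Lambda> B F) ((t, x), (\<tau>, v)) \<longleftrightarrow>
    causal M A (static_L (F_B \<Lambda> B F)) ((t, x), (\<tau>, v)) \<and>
    future_pointing (F_B \<Lambda> B F) ((t, x), (\<tau>, v))"
proof -
  have "static_L (F_B \<Lambda> B F) ((t, x), (\<tau>, v)) \<le> 0" if "F_B \<Lambda> B F x v \<le> \<tau>"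
    using F_B_nonneg assms(1) that by (intro static_L_nonpos_if_le_abs) simp_all
  then show ?thesis
    unfolding causal_def split_L_nonpos_iff_F_B_le[where \<Lambda> = \<Lambda> and x = x, OF assms]
      future_pointing.simps
    by blast
qed

lemma causal_split_L_iff_past_pointing:
  assumes "\<Lambda> x > 0" and "\<tau> < 0"
  shows "causal M A (split_L \<Lambda> B F) ((t, x), (\<tau>, v)) \<longleftrightarrow>
    causal M A (static_L (F_B_minus \<Lambda> B F)) ((t, x), (\<tau>, v)) \<and>
    past_pointing (F_B_minus \<Lambda> B F) ((t, x), (\<tau>, v))"
proof -
  have "split_L \<Lambda> B F ((t, x), (\<tau>, v)) \<le> 0 \<longleftrightarrow> F_B_minus \<Lambda> B F x v \<le> - \<tau>"
    unfolding F_B_minus_eq_F_B_uminus split_L_reflection[of \<Lambda> B F t x \<tau> v]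
    using assms by (intro split_L_nonpos_iff_F_B_le) simp_all
  moreover have "static_L (F_B_minus \<Lambda> B F) ((t, x), (\<tau>, v)) \<le> 0"
    if "F_B_minus \<Lambda> B F x v \<le> - \<tau>"
    using F_B_minus_nonneg assms that by (intro static_L_nonpos_if_le_abs) simp_all
  ultimately show ?thesis
    unfolding causal_def past_pointing.simps by (smt (verit, best))
qed

theorem proposition6p1:
  fixes M :: "'m topology" and A :: "('m, 'e::euclidean_space) chart set"
    and \<Lambda> :: "'m \<Rightarrow> real" and B F :: "'m \<Rightarrow> ('m, 'e) tvec \<Rightarrow> real"
  assumes "smooth_manifold M A"
    and "smooth_function A \<Lambda>" and "\<And>x. x \<in> topspace M \<Longrightarrow> \<Lambda> x > 0"
    and "pos_homogeneous1 M A B" and "Ck_TM_minus_zero 3 A B"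
    and "finsler_metric M A F"
  shows
    "(fiber_hessian_pos_semidef M A B \<and>
      (\<forall>x\<in>topspace M. (\<forall>v\<in>tangent_space A x. B x v \<ge> 0) \<or> fiber_linear A B x) \<longrightarrow>
        (\<forall>t x \<tau> v. ((t, x), (\<tau>, v)) \<in> split_TM M A \<and> \<tau> > 0 \<longrightarrow>
          (causal M A (split_L \<Lambda> B F) ((t, x), (\<tau>, v)) \<longleftrightarrow>
           causal M A (static_L (F_B \<Lambda> B F)) ((t, x), (\<tau>, v)) \<and>
           future_pointing (F_B \<Lambda> B F) ((t, x), (\<tau>, v))))) \<and>
     (fiber_hessian_neg_semidef M A B \<and>
      (\<forall>x\<in>topspace M. (\<forall>v\<in>tangent_space A x. B x v \<le> 0) \<or> fiber_linear A B x) \<longrightarrow>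
        (\<forall>t x \<tau> v. ((t, x), (\<tau>, v)) \<in> split_TM M A \<and> \<tau> < 0 \<longrightarrow>
          (causal M A (split_L \<Lambda> B F) ((t, x), (\<tau>, v)) \<longleftrightarrow>
           causal M A (static_L (F_B_minus \<Lambda> B F)) ((t, x), (\<tau>, v)) \<and>
           past_pointing (F_B_minus \<Lambda> B F) ((t, x), (\<tau>, v)))))"
proof -
  have pos: "\<Lambda> x > 0" if "((t, x), (\<tau>, v)) \<in> split_TM M A" for t x \<tau> v
    using that assms(3) by (auto simp: split_TM_def)
  show ?thesis
    by (intro conjI impI allI; elim conjE)
      (rule causal_split_L_iff_future_pointing causal_split_L_iff_past_pointing;
        auto dest: pos)+
qed

end
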